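(* Let $m\in\mathbb{N}=\{1,2,\dots\}$ and let $E\subset\mathbb{R}^m$ be a set of zero relative Lebesgue density, i.e. ${\sf L}_m(E)=0$. If $v$ is a subharmonic function of finite order on $\mathbb{R}^m$ that is bounded above on $\mathbb{R}^m\setminus E$, then $$\sup_{\mathbb{R}^m} v=\sup_{\mathbb{R}^m\setminus E} v<+\infty .$$
   Context: $\lambda$ is Lebesgue measure on $\mathbb{R}^m$, $|\cdot|$ is the Euclidean norm, and $B(r)$ is the ball of radius $r$ centred at $0$. The relative Lebesgue density of a Lebesgue measurable set $E\subset\mathbb{R}^m$ is ${\sf L}_m(E):=\lim_{r\to+\infty}\lambda(E\cap B(r))/r^m$, if the limit exists; ${\sf L}_m(E)=0$ means that $E$ is Lebesgue measurable and this limit exists and equals $0$. The order of an extended-real-valued function $M$ on $\mathbb{R}^m$ is $\limsup_{|x|\to\infty}\dfrac{\ln(1+M^+(x))}{\ln|x|}\in[0,+\infty]$, where $M^+:=\max\{0,M\}$; $M$ has finite order if this quantity is $<+\infty$. Subharmonic functions take values in $[-\infty,+\infty)$; for $m=1$, subharmonic functions on $\mathbb{R}$ are by convention exactly the convex functions. *)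

theory Defs
  imports "HOL-Analysis.Analysis"
begin

definition has_relative_density :: "(real ^ 'n) set \<Rightarrow> real \<Rightarrow> bool" where
  "has_relative_density E d \<longleftrightarrow>
     E \<in> sets lebesgue \<and>
     ((\<lambda>r. measure lebesgue (E \<inter> ball 0 r) / r ^ CARD('n)) \<longlongrightarrow> d) at_top"

definition ereal_ln :: "ereal \<Rightarrow> ereal" where
  "ereal_ln y = (if y \<le> 0 then -\<infinity> else if y = \<infinity> then \<infinity> else ereal (ln (real_of_ereal y)))"

definition growth_order :: "(real ^ 'n \<Rightarrow> ereal) \<Rightarrow> ereal" where
  "growth_order M =
     Limsup at_infinity (\<lambda>x. ereal_ln (1 + max 0 (M x)) / ereal (ln (norm x)))"

definition finite_order :: "(real ^ 'n \<Rightarrow> ereal) \<Rightarrow> bool" where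
  "finite_order M \<longleftrightarrow> growth_order M < \<infinity>"

definition upper_semicontinuous :: "('a::topological_space \<Rightarrow> ereal) \<Rightarrow> bool" where
  "upper_semicontinuous f \<longleftrightarrow> (\<forall>c. open {x. f x < c})"

definition ereal_convex :: "('a::real_vector \<Rightarrow> ereal) \<Rightarrow> bool" where
  "ereal_convex f \<longleftrightarrow>
     (\<forall>x y t. 0 < t \<and> t < 1 \<longrightarrow>
        f ((1 - t) *\<^sub>R x + t *\<^sub>R y) \<le> ereal (1 - t) * f x + ereal t * f y)"

(* Integral of an extended-real function as positive part minus negative part
   (e2ennreal sends negative values to 0).  It is meaningful when the positive part has a finite
   integral, which holds for upper semicontinuous functions with values in [-\<infinity>, \<infinity>) on closed
   balls; the integral may be -\<infinity>. *)
definition ereal_integral :: "'a measure \<Rightarrow> ('a \<Rightarrow> ereal) \<Rightarrow> ereal" where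
  "ereal_integral M f =
     enn2ereal (\<integral>\<^sup>+ x. e2ennreal (f x) \<partial>M) - enn2ereal (\<integral>\<^sup>+ x. e2ennreal (- f x) \<partial>M)"

definition ball_mean :: "(real ^ 'n \<Rightarrow> ereal) \<Rightarrow> real ^ 'n \<Rightarrow> real \<Rightarrow> ereal" where
  "ball_mean f x r =
     ereal_integral (lebesgue_on (cball x r)) f / ereal (measure lebesgue (cball x r))"

(* Subharmonic on the whole space: upper semicontinuous with the volume sub-mean value property
   on every ball.  In dimension one the subharmonic functions are the convex ones.  The constant
   -\<infinity> is included. *)
definition subharmonic :: "(real ^ 'n \<Rightarrow> ereal) \<Rightarrow> bool" where
  "subharmonic v \<longleftrightarrow>
     (\<forall>x. v x < \<infinity>) \<and>
     (if CARD('n) = 1 then ereal_convex v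
      else upper_semicontinuous v \<and> (\<forall>x r. 0 < r \<longrightarrow> v x \<le> ball_mean v x r))"

end

theory Submission
  imports Defs
begin

text \<open>If \<open>v \<le> S\<close> off \<open>E\<close>, let \<open>M(R)\<close> be the supremum over \<open>|x| \<le> R\<close> of the positive part of
  \<open>v - S\<close>.  The sub-mean value property on balls of radius \<open>R\<close> gives
  \<open>M(R) \<le> \<epsilon>(R) M(2R)\<close> with \<open>\<epsilon>(R) \<rightarrow> 0\<close>, because only the part of the ball inside \<open>E\<close>
  contributes.  Iterating, \<open>M\<close> would grow faster than every power unless it vanishes.  In the convex
  case midpoint convexity at a point \<open>x\<close> with \<open>v x > S\<close> puts \<open>x + t\<close> or \<open>x - t\<close> into
  \<open>E\<close> for every \<open>t\<close>, so \<open>E\<close> has at least half the measure of every ball around \<open>x\<close>.\<close>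

section \<open>Semicontinuity, finite order and a global polynomial bound\<close>

lemma upper_semicontinuous_borel_measurable:
  fixes f :: "'a::topological_space \<Rightarrow> ereal"
  assumes "upper_semicontinuous f"
  shows "f \<in> borel_measurable borel"
proof (rule borel_measurableI_less)
  fix c
  have "open {x. f x < c}" using assms by (simp add: upper_semicontinuous_def)
  then show "{x \<in> space borel. f x < c} \<in> sets borel" by simp
qed

lemma upper_semicontinuous_bdd_above_compact:
  fixes f :: "'a::topological_space \<Rightarrow> ereal"
  assumes usc: "upper_semicontinuous f" and fin: "\<And>x. f x < \<infinity>" and K: "compact K"
  obtains A :: real where "0 \<le> A" "\<And>x. x \<in> K \<Longrightarrow> f x \<le> ereal A"
proof -
  define U where "U n = {x. f x < ereal (real n)}" for n :: nat
  have cover: "K \<subseteq> (\<Union>n\<in>UNIV. U n)"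
  proof
    fix x
    have "f x \<noteq> \<infinity>" using fin[of x] by simp
    then obtain n :: nat where "f x < ereal (real n)"
      unfolding less_PInf_Ex_of_nat by (elim exE)
    then have "x \<in> U n" by (simp add: U_def)
    then show "x \<in> (\<Union>n\<in>UNIV. U n)" by blast
  qed
  have "open (U n)" for n
    using usc by (simp add: U_def upper_semicontinuous_def)
  then obtain I where I: "I \<subseteq> UNIV" "finite I" "K \<subseteq> (\<Union>n\<in>I. U n)"
    by (rule compactE_image[OF K _ cover])
  show thesis
  proof
    \<comment> \<open>Inserting 0 keeps the maximum meaningful when the finite subcover is
      empty.\<close>
    show "0 \<le> real (Max (insert 0 I))" by (rule of_nat_0_le_iff)
    fix x assume "x \<in> K"
    then obtain n where n: "n \<in> I" "x \<in> U n" using I(3) by blast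
    have "n \<le> Max (insert 0 I)" using n(1) I(2) by (intro Max_ge) simp_all
    have "f x \<le> ereal (real n)" using n(2) by (simp add: U_def less_imp_le)
    also have "\<dots> \<le> ereal (real (Max (insert 0 I)))"
      using \<open>n \<le> Max (insert 0 I)\<close> by simp
    finally show "f x \<le> ereal (real (Max (insert 0 I)))" .
  qed
qed

lemma finite_order_imp_eventually_le_power:
  fixes v :: "real ^ 'n \<Rightarrow> ereal"
  assumes "finite_order v" and fin: "\<And>x. v x < \<infinity>"
  obtains k :: nat and K :: real where "\<And>x. K \<le> norm x \<Longrightarrow> v x \<le> ereal (norm x ^ k)"
proof -
  let ?q = "\<lambda>x. ereal_ln (1 + max 0 (v x)) / ereal (ln (norm x))"
  have "Limsup at_infinity ?q \<noteq> \<infinity>"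
    using assms(1) by (simp add: finite_order_def growth_order_def)
  then obtain k :: nat where "Limsup at_infinity ?q < ereal (real k)"
    unfolding less_PInf_Ex_of_nat by (elim exE)
  then have "eventually (\<lambda>x. ?q x < ereal (real k)) at_infinity"
    by (rule Limsup_lessD)
  then obtain K where K: "\<And>x. K \<le> norm x \<Longrightarrow> ?q x < ereal (real k)"
    unfolding eventually_at_infinity by blast
  show thesis
  proof
    \<comment> \<open>From radius 2 on, \<open>ln (norm x)\<close> is positive, so the order
      quotient below \<open>k\<close> can be cleared of its denominator and exponentiated.\<close>
    fix x :: "real^'n" assume x: "max K 2 \<le> norm x"
    show "v x \<le> ereal (norm x ^ k)"
    proof (cases "v x")
      case (real a)
      define b where "b = 1 + max 0 a"
      have b: "b \<ge> 1" "a \<le> b" by (auto simp: b_def)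
      have eq: "1 + max 0 (v x) = ereal b"
        unfolding real b_def by (auto simp: max_def)
      have ln: "ln (norm x) > 0" using x by (intro ln_gt_zero) auto
      have "?q x = ereal (ln b / ln (norm x))"
        unfolding eq using b ln by (simp add: ereal_ln_def)
      then have "ln b / ln (norm x) < real k" using K[of x] x by simp
      then have "ln b < real k * ln (norm x)" using ln by (simp add: field_simps)
      also have "\<dots> = ln (norm x ^ k)" using x by (simp add: ln_realpow)
      finally have "b < norm x ^ k" using b zero_less_power[of "norm x" k] x
        by (subst (asm) ln_less_cancel_iff) (linarith | simp)+
      then show ?thesis using b real by simp
    qed (use fin[of x] in auto)
  qed
qed

text \<open>The iteration over radii starts from a bound at every point. The order controls only
  large \<open>norm x\<close>; compactness of \<open>cball 0 K\<close> supplies the constant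
  \<open>A\<close> for the rest.\<close>

lemma upper_semicontinuous_finite_order_growth:
  fixes v :: "real ^ 'n \<Rightarrow> ereal"
  assumes "upper_semicontinuous v" "finite_order v" "\<And>x. v x < \<infinity>"
  obtains A :: real and k :: nat where "\<And>x. v x \<le> ereal (A + norm x ^ k)"
proof -
  obtain k K where K: "\<And>x. K \<le> norm x \<Longrightarrow> v x \<le> ereal (norm x ^ k)"
    using finite_order_imp_eventually_le_power[OF assms(2,3)] by blast
  obtain A where A: "0 \<le> A" "\<And>x. x \<in> cball 0 K \<Longrightarrow> v x \<le> ereal A"
    using upper_semicontinuous_bdd_above_compact[OF assms(1,3) compact_cball] by blast
  have "v x \<le> ereal (A + norm x ^ k)" for x
  proof (cases "K \<le> norm x")
    case True
    have "ereal (norm x ^ k) \<le> ereal (A + norm x ^ k)" using A by simp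
    with K[OF True] show ?thesis by (rule order_trans)
  next
    case False
    have "ereal A \<le> ereal (A + norm x ^ k)" by simp
    moreover have "v x \<le> ereal A" using A(2)[of x] False by simp
    ultimately show ?thesis by (rule order_trans[rotated])
  qed
  then show thesis by (rule that)
qed

section \<open>Averages over balls in which the exceptional set is small\<close>

lemma sub_mean_value_le:
  fixes v :: "real ^ 'n \<Rightarrow> ereal"
  assumes meas: "v \<in> borel_measurable borel" and E: "E \<in> sets lebesgue"
    and r: "0 < r" and sub: "v x \<le> ball_mean v x r" and M: "0 \<le> M"
    and le: "\<And>y. y \<in> cball x r \<Longrightarrow> v y \<le> ereal (S + M * indicator E y)"
    and fin: "v x < \<infinity>"
  shows "v x \<le> ereal (S + M * (measure lebesgue (E \<inter> cball x r) / measure lebesgue (cball x r)))"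
\<comment> \<open>The right side is the mean of \<open>S + M * indicator E\<close> over the ball.
  The work lies in comparing means when the integral of \<open>v\<close> is defined as a difference
  of two extended integrals.\<close>
proof (cases "v x")
  case (real a)
  let ?C = "cball x r"
  let ?L = "lebesgue_on ?C"
  define \<mu> where "\<mu> = measure lebesgue ?C"
  define e where "e = measure lebesgue (E \<inter> ?C)"
  define P where "P = (\<integral>\<^sup>+ y. e2ennreal (v y) \<partial>?L)"
  define N where "N = (\<integral>\<^sup>+ y. e2ennreal (- v y) \<partial>?L)"
  have \<mu>: "\<mu> > 0" unfolding \<mu>_def using r by (simp add: content_cball_pos)
  have C: "emeasure ?L (space ?L) = ennreal \<mu>"
    using emeasure_eq_measure2[OF lmeasurable_cball, of x r]
    unfolding \<mu>_def by (simp add: emeasure_restrict_space)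
  have EC: "E \<inter> ?C \<in> sets ?L" using E by (auto simp: sets_restrict_space)
  have lm: "E \<inter> ?C \<in> lmeasurable"
    using E by (intro bounded_set_imp_lmeasurable) (auto intro: bounded_subset[OF bounded_cball])
  have eC: "emeasure ?L (E \<inter> ?C) = ennreal e"
    unfolding e_def using lm by (simp add: emeasure_restrict_space emeasure_eq_measure2)
  have [measurable]: "v \<in> borel_measurable ?L"
    using meas by (intro measurable_restrict_space1 measurable_completion) simp
  have [measurable]: "(\<lambda>y. indicator (E \<inter> ?C) y :: ennreal) \<in> borel_measurable ?L"
    using EC by simp
  have sp: "space ?L = ?C" by simp
  \<comment> \<open>A crude bound whose only purpose is that \<open>P\<close> is finite, so that
    \<open>P - N\<close> is not infinity minus infinity.\<close>
  have pos: "P \<le> ennreal ((max 0 S + M) * \<mu>)"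
  proof -
    have "P \<le> (\<integral>\<^sup>+ y. ennreal (max 0 S + M) \<partial>?L)"
      unfolding P_def
    proof (rule nn_integral_mono)
      fix y assume "y \<in> space ?L"
      then have "v y \<le> ereal (S + M * indicator E y)" using le by simp
      also have "\<dots> \<le> ereal (max 0 S + M)" using M by (auto simp: indicator_def)
      finally have "e2ennreal (v y) \<le> e2ennreal (ereal (max 0 S + M))" by (rule e2ennreal_mono)
      then show "e2ennreal (v y) \<le> ennreal (max 0 S + M)" by simp
    qed
    also have "\<dots> = ennreal ((max 0 S + M) * \<mu>)"
      using C M by (simp add: ennreal_mult')
    finally show ?thesis .
  qed
  \<comment> \<open>To stay within nonnegative integrands, v <= S + M 1_E is rearranged, with
    positive and negative parts, as v^+ + S^- <= v^- + S^+ + M 1_E.\<close>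
  have "P + ennreal (max 0 (-S) * \<mu>) = (\<integral>\<^sup>+ y. e2ennreal (v y) + ennreal (max 0 (-S)) \<partial>?L)"
    unfolding P_def using C by (simp add: nn_integral_add ennreal_mult')
  also have "\<dots> \<le> (\<integral>\<^sup>+ y. e2ennreal (- v y) + (ennreal (max 0 S) + ennreal M * indicator (E \<inter> ?C) y) \<partial>?L)"
  proof (rule nn_integral_mono)
    fix y assume "y \<in> space ?L"
    then have y: "y \<in> ?C" by simp
    show "e2ennreal (v y) + ennreal (max 0 (- S))
        \<le> e2ennreal (- v y) + (ennreal (max 0 S) + ennreal M * indicator (E \<inter> ?C) y)"
    proof (cases "v y")
      case (real b)
      have b: "b \<le> S + M * indicator E y" using le[OF y] real by simp
      have "ennreal (max 0 b + max 0 (-S)) \<le> ennreal (max 0 (-b) + (max 0 S + M * indicator E y))"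
        using b M by (intro ennreal_leI) (auto simp: max_def indicator_def)
      then have "ennreal (max 0 b) + ennreal (max 0 (-S))
          \<le> ennreal (max 0 (-b)) + (ennreal (max 0 S) + ennreal (M * indicator E y))"
        using M by (simp add: ennreal_plus del: ennreal_max_0)
      moreover have "ennreal (M * indicator E y) = ennreal M * indicator (E \<inter> ?C) y"
        using y by (simp add: indicator_def)
      moreover have "ennreal (max 0 t) = ennreal t" for t
        by (auto simp: max_def ennreal_neg)
      ultimately show ?thesis using real by simp
    next
      case PInf
      then show ?thesis using le[OF y] by simp
    next
      \<comment> \<open>The term \<open>e2ennreal (- v y)\<close> is infinite, so the right side is
        too.\<close>
      case MInf
      then show ?thesis by simp
    qed
  qed
  also have "\<dots> = N + (ennreal (max 0 S * \<mu>) + ennreal (M * e))"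
    unfolding N_def using C eC EC M by (simp add: nn_integral_add nn_integral_cmult ennreal_mult')
  finally have main: "P + ennreal (max 0 (-S) * \<mu>) \<le> N + (ennreal (max 0 S * \<mu>) + ennreal (M * e))" .
  obtain p where p: "P = ennreal p" "p \<ge> 0"
    using pos by (cases P) (auto simp: top_unique)
  have bm: "ereal a \<le> (enn2ereal P - enn2ereal N) / ereal \<mu>"
    using sub unfolding real ball_mean_def ereal_integral_def P_def N_def \<mu>_def by simp
  \<comment> \<open>As \<open>P\<close> is finite, an infinite \<open>N\<close> would make the mean
    minus infinity, below the real value \<open>a\<close>.\<close>
  have "N \<noteq> top"
  proof
    assume "N = top"
    then have "(enn2ereal P - enn2ereal N) / ereal \<mu> = -\<infinity>"
      using p \<mu> by (simp add: enn2ereal_ennreal)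
    then show False using bm by simp
  qed
  then obtain n where n: "N = ennreal n" "n \<ge> 0" by (cases N) auto
  have e: "e \<ge> 0" by (simp add: e_def)
  have "a \<le> (p - n) / \<mu>" using bm p n \<mu> by (simp add: enn2ereal_ennreal)
  then have 1: "a * \<mu> \<le> p - n" using \<mu> by (simp add: field_simps)
  have "ennreal (p + max 0 (-S) * \<mu>) \<le> ennreal (n + (max 0 S * \<mu> + M * e))"
    using main p n \<mu> M e by (simp add: ennreal_plus)
  then have "p + max 0 (-S) * \<mu> \<le> n + (max 0 S * \<mu> + M * e)"
    using n \<mu> M e by (subst (asm) ennreal_le_iff) auto
  moreover have "max 0 S * \<mu> = S * \<mu> + max 0 (-S) * \<mu>" by (auto simp: max_def)
  ultimately have "a * \<mu> \<le> S * \<mu> + M * e" using 1 by linarith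
  then have "a \<le> S + M * (e / \<mu>)" using \<mu> by (simp add: field_simps)
  then show ?thesis using real by (simp add: e_def \<mu>_def)
qed (use fin in auto)

text \<open>Density is measured in balls about 0. A ball of radius R whose centre has norm at most R
  fits into \<open>ball 0 (3 * R)\<close>, which is larger in volume only by a fixed factor, so the
  smallness is uniform in such centres.\<close>

lemma zero_relative_density_imp_small_in_balls:
  fixes E :: "(real ^ 'n) set"
  assumes E: "has_relative_density E 0" and q: "0 < q"
  obtains R0 :: real where "0 < R0"
    "\<And>R x. R0 \<le> R \<Longrightarrow> norm x \<le> R \<Longrightarrow>
       measure lebesgue (E \<inter> cball x R) \<le> q * measure lebesgue (cball x R)"
proof -
  let ?m = "CARD('n)"
  have lim: "((\<lambda>r. measure lebesgue (E \<inter> ball 0 r) / r ^ ?m) \<longlongrightarrow> 0) at_top"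
    and Em: "E \<in> sets lebesgue" using E by (auto simp: has_relative_density_def)
  define c where "c = measure lebesgue (cball (0::real^'n) 1)"
  have c: "c > 0" by (simp add: c_def content_cball_pos)
  have vol: "measure lebesgue (cball x R) = c * R ^ ?m" if "R \<ge> 0" for x :: "real^'n" and R
    using that by (simp add: c_def content_cball)
  \<comment> \<open>The unit ball volume \<open>c\<close> turns the normalisation by r^m into a
    fraction of volume; dividing by 3^m pays for the passage to radius 3R.\<close>
  have "eventually (\<lambda>r. measure lebesgue (E \<inter> ball 0 r) / r ^ ?m < q * c / 3 ^ ?m) at_top"
    using q c by (intro order_tendstoD(2)[OF lim]) auto
  then obtain r0 where r0: "\<And>r. r \<ge> r0 \<Longrightarrow> measure lebesgue (E \<inter> ball 0 r) / r ^ ?m < q * c / 3 ^ ?m"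
    unfolding eventually_at_top_linorder by blast
  show thesis
  proof
    show "0 < max 1 r0" by simp
    fix R and x :: "real^'n" assume R: "max 1 r0 \<le> R" and x: "norm x \<le> R"
    \<comment> \<open>Norms reach at most 2R; the factor 3 leaves room for the open ball, since R >=
      1.\<close>
    have "E \<inter> cball x R \<subseteq> E \<inter> ball 0 (3 * R)"
    proof
      fix y assume y: "y \<in> E \<inter> cball x R"
      have "norm y \<le> norm x + dist x y" by norm
      then show "y \<in> E \<inter> ball 0 (3 * R)" using y x R by auto
    qed
    moreover have "E \<inter> ball 0 (3 * R) \<in> lmeasurable"
      using Em by (intro bounded_set_imp_lmeasurable) (auto intro: bounded_subset[OF bounded_ball])
    ultimately have "measure lebesgue (E \<inter> cball x R) \<le> measure lebesgue (E \<inter> ball 0 (3 * R))"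
      using Em by (intro measure_mono_fmeasurable) auto
    also have "\<dots> \<le> q * c / 3 ^ ?m * (3 * R) ^ ?m"
      using r0[of "3 * R"] R by (simp add: divide_less_eq less_imp_le)
    also have "\<dots> = q * measure lebesgue (cball x R)"
      using R vol[of R x] by (simp add: power_mult_distrib)
    finally show "measure lebesgue (E \<inter> cball x R) \<le> q * measure lebesgue (cball x R)" .
  qed
qed

section \<open>Iteration over doubled radii\<close>

lemma sub_mean_value_le_of_zero_density:
  fixes v :: "real ^ 'n \<Rightarrow> ereal"
  assumes E: "has_relative_density E 0" and usc: "upper_semicontinuous v"
    and fin: "\<And>x. v x < \<infinity>" and sub: "\<And>x r. 0 < r \<Longrightarrow> v x \<le> ball_mean v x r"
    and ord: "finite_order v" and S: "\<And>x. x \<notin> E \<Longrightarrow> v x \<le> ereal S"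
  shows "v x \<le> ereal S"
proof -
  obtain A k where growth: "\<And>x. v x \<le> ereal (A + norm x ^ k)"
    using upper_semicontinuous_finite_order_growth[OF usc ord fin] by blast
  \<comment> \<open>Doubling the radius multiplies r^k by 2^k; this choice of \<open>q\<close> still
    leaves a net factor 1/2 per step.\<close>
  define q :: real where "q = (1/2) ^ Suc k"
  have q: "0 < q" "q < 1" unfolding q_def by (simp, rule power_Suc_less_one) auto
  obtain R0 where R0: "0 < R0" "\<And>R x. R0 \<le> R \<Longrightarrow> norm x \<le> R \<Longrightarrow>
       measure lebesgue (E \<inter> cball x R) \<le> q * measure lebesgue (cball x R)"
    using zero_relative_density_imp_small_in_balls[OF E q(1)] by metis
  \<comment> \<open>\<open>B r\<close> dominates v - S on the ball of radius r about 0.\<close>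
  define B where "B r = \<bar>A - S\<bar> + r ^ k" for r
  have B: "r \<ge> 0 \<Longrightarrow> B r \<ge> 0" for r by (simp add: B_def)
  have iter: "v x \<le> ereal (S + q ^ n * B (2 ^ n * R))" if "R0 \<le> R" "norm x \<le> R" for n R x
    using that
  \<comment> \<open>The radius and the point vary because the step at R applies the hypothesis with
    2R at all points of \<open>E\<close> in \<open>cball x R\<close>; off \<open>E\<close> the bound
    \<open>S\<close> is already known.\<close>
  proof (induction n arbitrary: R x)
    case 0
    have "norm x ^ k \<le> R ^ k" using 0 by (intro power_mono) auto
    then have "A + norm x ^ k \<le> S + B R" unfolding B_def by linarith
    then show ?case using growth[of x] order_trans by fastforce
  next
    case (Suc n)
    define M where "M = q ^ n * B (2 ^ n * (2 * R))"
    have R: "R > 0" using Suc R0 by linarith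
    have M: "M \<ge> 0" unfolding M_def using q R by (intro mult_nonneg_nonneg B) auto
    have "v y \<le> ereal (S + M * indicator E y)" if "y \<in> cball x R" for y
    proof (cases "y \<in> E")
      case True
      have "norm y \<le> norm x + dist x y" by norm
      then have "norm y \<le> 2 * R" using that Suc.prems by auto
      then show ?thesis using Suc.IH[of "2 * R" y] Suc.prems R True by (simp add: M_def)
    qed (use S in auto)
    then have "v x \<le> ereal (S + M * (measure lebesgue (E \<inter> cball x R) / measure lebesgue (cball x R)))"
      using sub_mean_value_le[OF upper_semicontinuous_borel_measurable[OF usc] _ R sub[OF R] M]
        E fin[of x] by (simp add: has_relative_density_def)
    also have "\<dots> \<le> ereal (S + M * q)"
      using R0(2)[OF Suc.prems] R M
      by (auto intro!: mult_left_mono simp: pos_divide_le_eq[OF content_cball_pos] simp del: times_divide_eq_right)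
    also have "S + M * q = S + q ^ Suc n * B (2 ^ Suc n * R)" by (simp add: M_def mult_ac)
    finally show ?case .
  qed
  \<comment> \<open>Now \<open>x\<close> and \<open>R\<close> stay fixed while n tends to infinity,
    and both terms of the excess over \<open>S\<close> vanish.\<close>
  define R where "R = max R0 (norm x)"
  have "v x \<le> ereal (S + q ^ n * B (2 ^ n * R))" for n
    by (rule iter) (auto simp: R_def)
  moreover have "q ^ n * B (2 ^ n * R) = q ^ n * \<bar>A - S\<bar> + (1/2) ^ n * R ^ k" for n
  proof -
    have "q ^ n * (2 ^ n) ^ k = (1/2) ^ n"
      by (simp add: q_def power_mult_distrib power_divide power_mult[symmetric] mult.commute)
    then show ?thesis by (simp add: B_def distrib_left power_mult_distrib mult.assoc[symmetric])
  qed
  moreover have "(\<lambda>n. q ^ n * \<bar>A - S\<bar> + (1/2) ^ n * R ^ k) \<longlonglongrightarrow> 0 * \<bar>A - S\<bar> + 0 * R ^ k"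
    using q by (intro tendsto_intros LIMSEQ_realpow_zero) auto
  ultimately have "(\<lambda>n. ereal (S + q ^ n * B (2 ^ n * R))) \<longlonglongrightarrow> ereal (S + 0)"
    by (intro tendsto_intros) simp
  then have "v x \<le> ereal (S + 0)"
    by (rule LIMSEQ_le_const) (use \<open>\<And>n. v x \<le> ereal (S + q ^ n * B (2 ^ n * R))\<close> in blast)
  then show ?thesis by simp
qed

section \<open>The convex case by point reflection, in any dimension\<close>

lemma ereal_convex_le_of_zero_density:
  fixes v :: "real ^ 'n \<Rightarrow> ereal"
  assumes E: "has_relative_density E 0" and conv: "ereal_convex v"
    and S: "\<And>x. x \<notin> E \<Longrightarrow> v x \<le> ereal S"
  shows "v x \<le> ereal S"
proof (rule ccontr)
  assume x: "\<not> v x \<le> ereal S"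
  \<comment> \<open>The point \<open>x\<close> is the midpoint of y and its mirror image; if both
    lay outside \<open>E\<close>, convexity would give v x <= S.\<close>
  have refl: "y \<in> E \<or> 2 *\<^sub>R x - y \<in> E" for y
  proof (rule ccontr)
    assume "\<not> (y \<in> E \<or> 2 *\<^sub>R x - y \<in> E)"
    then have "v y \<le> ereal S" "v (2 *\<^sub>R x - y) \<le> ereal S" using S by auto
    then have "ereal (1 - 1/2) * v y + ereal (1/2) * v (2 *\<^sub>R x - y)
        \<le> ereal (1 - 1/2) * ereal S + ereal (1/2) * ereal S"
      by (intro add_mono ereal_mult_left_mono) auto
    moreover have "v ((1 - 1/2) *\<^sub>R y + (1/2) *\<^sub>R (2 *\<^sub>R x - y))
        \<le> ereal (1 - 1/2) * v y + ereal (1/2) * v (2 *\<^sub>R x - y)"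
      using conv[unfolded ereal_convex_def, rule_format, of "1/2" y "2 *\<^sub>R x - y"] by simp
    moreover have "(1 - 1/2) *\<^sub>R y + (1/2) *\<^sub>R (2 *\<^sub>R x - y) = x"
      by (simp add: scaleR_diff_right)
    ultimately show False using x by simp
  qed
  \<comment> \<open>Any fraction below 1/2 serves: two sets of that relative size cannot cover the
    ball.\<close>
  obtain R0 where R0: "0 < R0" "\<And>R x. R0 \<le> R \<Longrightarrow> norm x \<le> R \<Longrightarrow>
       measure lebesgue (E \<inter> cball x R) \<le> (1/3) * measure lebesgue (cball x R)"
    using zero_relative_density_imp_small_in_balls[OF E, of "1/3"] by auto
  define R where "R = max R0 (norm x)"
  define F where "F = E \<inter> cball x R"
  have R: "R > 0" using R0 by (simp add: R_def)
  have F: "F \<in> lmeasurable"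
    unfolding F_def using E
    by (intro bounded_set_imp_lmeasurable) (auto simp: has_relative_density_def intro: bounded_subset[OF bounded_cball])
  \<comment> \<open>The mirror image of \<open>F\<close> in \<open>x\<close>, written as an affine
    map with factor -1 so that the scaling law for Lebesgue measure shows equal measure.\<close>
  define G where "G = (\<lambda>y. 2 *\<^sub>R x + (-1) *\<^sub>R y) ` F"
  have G: "G \<in> lmeasurable" "measure lebesgue G = measure lebesgue F"
  proof -
    have "(\<lambda>y. 2 *\<^sub>R x + (-1) *\<^sub>R y) differentiable_on F"
      by (intro derivative_intros)
    then have "G \<in> sets lebesgue"
      unfolding G_def using F by (intro differentiable_image_in_sets_lebesgue) auto
    moreover have "emeasure lebesgue G = emeasure lebesgue F"
      unfolding G_def using emeasure_lebesgue_affine[of "-1" "2 *\<^sub>R x" F] by (simp add: add.commute)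
    ultimately show "G \<in> lmeasurable" "measure lebesgue G = measure lebesgue F"
      using F by (auto simp: fmeasurable_def measure_def)
  qed
  have "cball x R \<subseteq> F \<union> G"
  proof
    fix y assume y: "y \<in> cball x R"
    have "dist x (2 *\<^sub>R x - y) = dist x y"
      by (simp add: dist_norm scaleR_2 norm_minus_commute)
    then have "2 *\<^sub>R x - y \<in> cball x R" using y by simp
    moreover have "y = 2 *\<^sub>R x + (-1) *\<^sub>R (2 *\<^sub>R x - y)" by simp
    ultimately show "y \<in> F \<union> G" using refl[of y] y unfolding F_def G_def by blast
  qed
  then have "measure lebesgue (cball x R) \<le> measure lebesgue (F \<union> G)"
    using F G by (intro measure_mono_fmeasurable) auto
  also have "\<dots> \<le> measure lebesgue F + measure lebesgue G"
    using F G by (intro measure_Un_le) auto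
  also have "\<dots> = 2 * measure lebesgue F" using G by simp
  also have "\<dots> \<le> 2 / 3 * measure lebesgue (cball x R)"
    using R0(2)[of R x] by (simp add: F_def R_def)
  finally show False using content_cball_pos[OF R, of x] by simp
qed

section \<open>From real upper bounds to equality of suprema\<close>

theorem mainTheorem1:
  fixes E :: "(real ^ 'n) set" and v :: "real ^ 'n \<Rightarrow> ereal"
  assumes "has_relative_density E 0"
    and "subharmonic v"
    and "finite_order v"
    and "\<exists>C::real. \<forall>x \<in> - E. v x \<le> ereal C"
  shows "(SUP x. v x) = (SUP x \<in> - E. v x) \<and> (SUP x \<in> - E. v x) < \<infinity>"
proof -
  have bound: "v x \<le> ereal S" if S: "\<And>x. x \<notin> E \<Longrightarrow> v x \<le> ereal S" for S x
  proof (cases "CARD('n) = 1")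
    case True
    then show ?thesis
      using assms(2) by (intro ereal_convex_le_of_zero_density[OF assms(1) _ S]) (simp_all add: subharmonic_def)
  next
    case False
    then show ?thesis
      using assms(2)
      by (intro sub_mean_value_le_of_zero_density[OF assms(1) _ _ _ assms(3) S]) (simp_all add: subharmonic_def)
  qed
  obtain C where "\<forall>x \<in> - E. v x \<le> ereal C" using assms(4) by (elim exE)
  then have "(SUP x \<in> - E. v x) \<le> ereal C" by (intro SUP_least) (rule bspec)
  also have "\<dots> < \<infinity>" by simp
  finally have fin: "(SUP x \<in> - E. v x) < \<infinity>" .
  \<comment> \<open>The supremum off \<open>E\<close> may be minus infinity, whereas
    \<open>bound\<close> needs a real number; hence the comparison with every real \<open>S\<close>
    above that supremum.\<close>
  have "v x \<le> (SUP x \<in> - E. v x)" for x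
  proof (rule ereal_le_real)
    fix S assume S: "(SUP x \<in> - E. v x) \<le> ereal S"
    have "v y \<le> ereal S" if "y \<notin> E" for y
      using SUP_upper[of y "- E" v] that S by (intro order_trans[OF _ S]) simp
    then show "v x \<le> ereal S" by (rule bound)
  qed
  then have "(SUP x. v x) \<le> (SUP x \<in> - E. v x)" by (rule SUP_least)
  moreover have "(SUP x \<in> - E. v x) \<le> (SUP x. v x)"
    by (rule SUP_subset_mono[OF subset_UNIV order_refl])
  ultimately have "(SUP x. v x) = (SUP x \<in> - E. v x)" by (rule antisym)
  then show ?thesis using fin by (rule conjI)
qed

end
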